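(* Let $n \geq m \geq 2$ be integers and let $v$ be any vertex of the rectangular lattice $L_{n,m}$. If at least one of $n$ and $m$ is odd, then $$f_d(L_{n,m}, v) = n+m-1.$$ Otherwise (that is, if $n$ and $m$ are both even), $$n+m \leq f_d(L_{n,m}, v) \leq 2m+n-2.$$
   Context: $L_{n,m}$ denotes the $n$ by $m$ rectangular lattice (grid graph) on $nm$ vertices, i.e. the Cartesian product of a path on $n$ vertices and a path on $m$ vertices: its vertices are pairs $(x,y)$ with $1\le x\le n$, $1\le y\le m$, and two vertices are adjacent iff they agree in one coordinate and differ by exactly $1$ in the other. Explorer-Director game on a connected graph $G$ with starting vertex $v$: a token is initially at $v$ (so $v$ counts as visited). On each turn the Explorer names a distance $d$ such that at least one vertex of $G$ is at (shortest-path) distance exactly $d$ from the token's current position, and then the Director moves the token to a vertex of their choice at distance exactly $d$ from the current position. The Explorer wants to maximize, and the Director to minimize, the number of distinct vertices visited by the token; play continues until the Explorer can no longer force the token onto an unvisited vertex. $f_d(G,v)$ is the number of visited vertices at the end of the game under optimal play by both players; equivalently, it is the largest $k$ such that the Explorer has a (possibly adaptive) strategy guaranteeing, against every play of the Director, that at least $k$ distinct vertices (including $v$) are visited after finitely many turns. *)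

theory Defs
  imports Main "HOL-Library.Extended_Nat"
begin

text \<open>
  A simple graph is given by its vertex set \<open>V\<close> and its symmetric, irreflexive
  adjacency relation \<open>E \<subseteq> V \<times> V\<close>.
\<close>

definition lattice_verts :: "nat \<Rightarrow> nat \<Rightarrow> (nat \<times> nat) set" where
  "lattice_verts n m = {1..n} \<times> {1..m}"

definition lattice_adj :: "nat \<Rightarrow> nat \<Rightarrow> ((nat \<times> nat) \<times> (nat \<times> nat)) set" where
  "lattice_adj n m =
     {((x, y), (x', y')).
        (x, y) \<in> lattice_verts n m \<and> (x', y') \<in> lattice_verts n m \<and>
        (x = x' \<and> (y' = y + 1 \<or> y = y' + 1) \<or>
         y = y' \<and> (x' = x + 1 \<or> x = x' + 1))}"

text \<open>
  \<open>E ^^ k\<close> relates the endpoints of walks with exactly \<open>k\<close> edges, so the following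
  is the shortest-path distance; it is \<open>\<infinity>\<close> if there is no path.
\<close>

definition gdist :: "('a \<times> 'a) set \<Rightarrow> 'a \<Rightarrow> 'a \<Rightarrow> enat" where
  "gdist E u w = (INF k \<in> {k. (u, w) \<in> E ^^ k}. enat k)"

text \<open>
  A strategy of the Explorer maps the history of the game, i.e. the nonempty list of
  all token positions so far (oldest first), to the distance named next.
  The distances named earlier are determined by the strategy and the positions, so they
  need not be recorded.
\<close>

definition legal_strategy ::
    "'a set \<Rightarrow> ('a \<times> 'a) set \<Rightarrow> ('a list \<Rightarrow> nat) \<Rightarrow> bool" where
  "legal_strategy V E \<sigma> \<longleftrightarrow>
     (\<forall>h. h \<noteq> [] \<and> set h \<subseteq> V \<longrightarrow> (\<exists>w\<in>V. gdist E (last h) w = enat (\<sigma> h)))"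

text \<open>
  The plays from \<open>v\<close> in which the Explorer follows \<open>\<sigma>\<close>: \<open>p i\<close> is the position of
  the token after \<open>i\<close> turns, and the Director's choices are arbitrary. Plays are
  continued forever.
\<close>

definition is_play ::
    "'a set \<Rightarrow> ('a \<times> 'a) set \<Rightarrow> 'a \<Rightarrow> ('a list \<Rightarrow> nat) \<Rightarrow> (nat \<Rightarrow> 'a) \<Rightarrow> bool" where
  "is_play V E v \<sigma> p \<longleftrightarrow>
     p 0 = v \<and>
     (\<forall>i. p (Suc i) \<in> V \<and> gdist E (p i) (p (Suc i)) = enat (\<sigma> (map p [0..<Suc i])))"

definition explorer_guarantees ::
    "'a set \<Rightarrow> ('a \<times> 'a) set \<Rightarrow> 'a \<Rightarrow> nat \<Rightarrow> bool" where
  "explorer_guarantees V E v k \<longleftrightarrow>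
     (\<exists>\<sigma>. legal_strategy V E \<sigma> \<and>
        (\<forall>p. is_play V E v \<sigma> p \<longrightarrow> (\<exists>N. k \<le> card (p ` {0..N}))))"

text \<open>
  For a finite graph and \<open>v \<in> V\<close> the set below is nonempty and bounded by \<open>card V\<close>,
  so the maximum is meaningful.
\<close>

definition f_d :: "'a set \<Rightarrow> ('a \<times> 'a) set \<Rightarrow> 'a \<Rightarrow> nat" where
  "f_d V E v = Max {k. explorer_guarantees V E v k}"

end

theory Submission
  imports Defs
begin

text \<open>
  Naming the largest possible distance always sends the token to a corner, and at a corner
  \<open>c\<close> all \<open>n + m - 1\<close> distances \<open>0..n + m - 2\<close> are available. As long as some of them is not
  attained by a visited vertex, naming it gains a new vertex; hence the Explorer forces
  \<open>n + m - 1\<close> vertices. If \<open>n\<close> and \<open>m\<close> are even, naming \<open>(n + m) div 2 - 1\<close> from \<open>c\<close> and then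
  the largest distance leads to a corner \<open>c'\<close> at odd distance from \<open>c\<close>. By a parity argument,
  \<open>n + m - 1\<close> visited vertices cannot attain all distances from both \<open>c\<close> and \<open>c'\<close>, so one
  more vertex is gained.

  The Director stays inside a set that is closed, in the sense that every distance possible
  from one of its members is realised within the set. The two extreme columns together with
  the row of \<open>v\<close> always form such a set. If \<open>n\<close> is odd, so does a monotone path between
  opposite corners that passes through \<open>v\<close> and crosses the lattice along the middle column.
\<close>

section \<open>Games on arbitrary graphs\<close>

lemma gdist_refl: "gdist E u u = 0"
proof -
  have "gdist E u u \<le> enat 0"
    unfolding gdist_def by (rule INF_lower) simp
  then show ?thesis by (simp add: zero_enat_def[symmetric])
qed

text \<open>\<open>S\<close> is the set of visited vertices, \<open>u\<close> the token's position, and \<open>r\<close> the number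
  of turns the Explorer may still use.\<close>

primrec forces :: "'a set \<Rightarrow> ('a \<times> 'a) set \<Rightarrow> nat \<Rightarrow> nat \<Rightarrow> 'a set \<Rightarrow> 'a \<Rightarrow> bool" where
  "forces V E k 0 S u \<longleftrightarrow> k \<le> card S"
| "forces V E k (Suc r) S u \<longleftrightarrow> k \<le> card S \<or>
     (\<exists>d. (\<exists>w\<in>V. gdist E u w = enat d) \<and>
          (\<forall>w\<in>V. gdist E u w = enat d \<longrightarrow> forces V E k r (insert w S) w))"

lemma forces_card: "k \<le> card S \<Longrightarrow> forces V E k r S u"
  by (cases r) auto

lemma forces_Suc: "forces V E k r S u \<Longrightarrow> forces V E k (Suc r) S u"
proof (induction r arbitrary: S u)
  case 0
  then show ?case by simp
next
  case (Suc r)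
  show ?case
  proof (cases "k \<le> card S")
    case False
    with Suc.prems obtain d where "\<exists>w\<in>V. gdist E u w = enat d"
      and "\<forall>w\<in>V. gdist E u w = enat d \<longrightarrow> forces V E k r (insert w S) w"
      by auto
    with Suc.IH show ?thesis unfolding forces.simps(2)[of V E k "Suc r"] by blast
  qed simp
qed

lemma forces_mono: "r \<le> r' \<Longrightarrow> forces V E k r S u \<Longrightarrow> forces V E k r' S u"
  by (induction r' rule: dec_induct) (auto intro: forces_Suc simp del: forces.simps)

text \<open>Different replies of the Director may need different numbers of turns; since
  \<open>V\<close> is finite, their maximum serves for all. Later arguments can thus ignore turn
  counts.\<close>

lemma forces_step:
  assumes "finite V" and "\<exists>w\<in>V. gdist E u w = enat d"
    and "\<And>w. w \<in> V \<Longrightarrow> gdist E u w = enat d \<Longrightarrow> \<exists>r. forces V E k r (insert w S) w"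
  shows "\<exists>r. forces V E k r S u"
proof -
  obtain R where R: "forces V E k (R w) (insert w S) w" if "w \<in> V" "gdist E u w = enat d" for w
    using assms(3) by metis
  have "forces V E k (Max (R ` V)) (insert w S) w" if "w \<in> V" "gdist E u w = enat d" for w
    using forces_mono[OF _ R[OF that]] assms(1) that by simp
  then have "forces V E k (Suc (Max (R ` V))) S u"
    using assms(2) by auto
  then show ?thesis ..
qed

text \<open>Turns a win within \<open>r\<close> turns into one strategy on histories: always name a
  legal distance after which the remaining turns still suffice.\<close>

lemma explorer_guarantees_forces:
  assumes "v \<in> V" and "forces V E k r {v} v"
  shows "explorer_guarantees V E v k"
proof -
  \<comment> \<open>After \<open>h\<close>, \<open>length h - 1\<close> turns are over and the reply
    \<open>w\<close> uses one more, which leaves \<open>r - length h\<close>.\<close>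
  let ?wins = "\<lambda>h d. \<forall>w\<in>V. gdist E (last h) w = enat d \<longrightarrow>
    forces V E k (r - length h) (insert w (set h)) w"
  let ?legal = "\<lambda>h d. \<exists>w\<in>V. gdist E (last h) w = enat d"
  \<comment> \<open>A strategy must be legal on every history, even a hopeless one, so winning is
    demanded only where it is possible; distance 0 is always legal.\<close>
  define \<sigma> where "\<sigma> h = (SOME d. ?legal h d \<and> ((\<exists>d. ?legal h d \<and> ?wins h d) \<longrightarrow> ?wins h d))" for h
  have \<sigma>: "?legal h (\<sigma> h) \<and> ((\<exists>d. ?legal h d \<and> ?wins h d) \<longrightarrow> ?wins h (\<sigma> h))"
    if "last h \<in> V" for h
  proof -
    have "?legal h 0" using that gdist_refl[of E "last h"] by (auto simp: zero_enat_def)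
    then have "\<exists>d. ?legal h d \<and> ((\<exists>d. ?legal h d \<and> ?wins h d) \<longrightarrow> ?wins h d)"
      by blast
    then show ?thesis unfolding \<sigma>_def by (rule someI_ex)
  qed
  have "legal_strategy V E \<sigma>"
    unfolding legal_strategy_def using \<sigma> last_in_set by blast
  moreover have "\<exists>N. k \<le> card (p ` {0..N})" if p: "is_play V E v \<sigma> p" for p
  proof (rule ccontr)
    assume less: "\<not> ?thesis"
    have pV: "p i \<in> V" for i
      using p assms(1) by (cases i) (auto simp: is_play_def)
    have set: "set (map p [0..<Suc i]) = p ` {0..i}" for i
      by (simp add: atLeastLessThanSuc_atLeastAtMost del: upt_Suc)
    have last: "last (map p [0..<Suc i]) = p i" for i
      by simp
    have len: "length (map p [0..<Suc i]) = Suc i" for i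
      by simp
    \<comment> \<open>While fewer than \<open>k\<close> vertices are visited, the first disjunct of
      \<open>forces\<close> fails and the winning distance is named. With no turns left,
      \<open>forces\<close> itself says that \<open>k\<close> vertices are visited.\<close>
    have "forces V E k (r - i) (p ` {0..i}) (p i)" if "i \<le> r" for i
      using that
    proof (induction i)
      case 0
      then show ?case using assms p by (simp add: is_play_def)
    next
      case (Suc i)
      let ?h = "map p [0..<Suc i]"
      have "forces V E k (Suc (r - Suc i)) (p ` {0..i}) (p i)"
        using Suc by (simp add: Suc_diff_Suc del: forces.simps)
      then have "\<exists>d. ?legal ?h d \<and> ?wins ?h d"
        unfolding set last len forces.simps using less by blast
      then have "?wins ?h (\<sigma> ?h)"
        using \<sigma>[of ?h] pV unfolding last by blast
      moreover have "gdist E (p i) (p (Suc i)) = enat (\<sigma> ?h)"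
        using p unfolding is_play_def by blast
      ultimately have "forces V E k (r - Suc i) (insert (p (Suc i)) (p ` {0..i})) (p (Suc i))"
        unfolding set last len using pV by blast
      then show ?case by (simp add: atLeast0_atMost_Suc)
    qed
    from this[of r] less show False by simp
  qed
  ultimately show ?thesis unfolding explorer_guarantees_def by blast
qed

section \<open>Closed sets of the Director and the value \<open>f_d\<close>\<close>

definition director_closed :: "'a set \<Rightarrow> ('a \<times> 'a) set \<Rightarrow> 'a set \<Rightarrow> bool" where
  "director_closed V E W \<longleftrightarrow>
     W \<subseteq> V \<and> (\<forall>u\<in>W. \<forall>w\<in>V. \<exists>w'\<in>W. gdist E u w' = gdist E u w)"

lemma director_closed_bound:
  assumes "finite W" and "director_closed V E W" and "v \<in> W"
    and "explorer_guarantees V E v k"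
  shows "k \<le> card W"
proof -
  obtain \<sigma> where legal: "legal_strategy V E \<sigma>"
    and \<sigma>: "\<And>p. is_play V E v \<sigma> p \<Longrightarrow> \<exists>N. k \<le> card (p ` {0..N})"
    using assms(4) unfolding explorer_guarantees_def by blast
  have WV: "W \<subseteq> V" using assms(2) by (simp add: director_closed_def)
  have "\<exists>w\<in>W. gdist E (last h) w = enat (\<sigma> h)" if h: "h \<noteq> []" "set h \<subseteq> W" for h
  proof -
    obtain w where "w \<in> V" "gdist E (last h) w = enat (\<sigma> h)"
      using legal h WV unfolding legal_strategy_def by (meson subset_trans)
    moreover have "last h \<in> W" using h by auto
    ultimately show ?thesis
      using assms(2) unfolding director_closed_def by metis
  qed
  then have "\<forall>h. \<exists>w. h \<noteq> [] \<longrightarrow> set h \<subseteq> W \<longrightarrow> w \<in> W \<and> gdist E (last h) w = enat (\<sigma> h)"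
    by blast
  then obtain f where f: "\<And>h. h \<noteq> [] \<Longrightarrow> set h \<subseteq> W \<Longrightarrow>
      f h \<in> W \<and> gdist E (last h) (f h) = enat (\<sigma> h)"
    using choice[of "\<lambda>h w. h \<noteq> [] \<longrightarrow> set h \<subseteq> W \<longrightarrow> w \<in> W \<and> gdist E (last h) w = enat (\<sigma> h)"]
    by blast
  \<comment> \<open>\<open>H i\<close> is the history after \<open>i\<close> turns when the Director
    always replies with \<open>f\<close>, inside \<open>W\<close>.\<close>
  define H where "H i = ((\<lambda>h. h @ [f h]) ^^ i) [v]" for i
  define p where "p i = last (H i)" for i
  have H_Suc: "H (Suc i) = H i @ [f (H i)]" for i
    by (simp add: H_def)
  have H: "H i \<noteq> [] \<and> set (H i) \<subseteq> W" for i
  proof (induction i)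
    case 0
    then show ?case using assms(3) by (simp add: H_def)
  next
    case (Suc i)
    then show ?case using f[of "H i"] by (simp add: H_Suc)
  qed
  have hist: "map p [0..<Suc i] = H i" for i
  proof (induction i)
    case 0
    then show ?case by (simp add: p_def H_def)
  next
    case (Suc i)
    then show ?case by (simp add: H_Suc p_def)
  qed
  have pW: "p i \<in> W" for i
    using H[of i] by (auto simp: p_def)
  have "is_play V E v \<sigma> p"
    unfolding is_play_def hist
  proof (intro conjI allI)
    show "p 0 = v" by (simp add: p_def H_def)
    show "p (Suc i) \<in> V" for i using pW WV by blast
    show "gdist E (p i) (p (Suc i)) = enat (\<sigma> (H i))" for i
      using f[of "H i"] H[of i] by (simp add: p_def H_Suc)
  qed
  then obtain N where "k \<le> card (p ` {0..N})" using \<sigma> by blast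
  also have "\<dots> \<le> card W"
    using pW by (intro card_mono assms(1)) auto
  finally show ?thesis .
qed

lemma f_d_upper:
  assumes "finite W" and "director_closed V E W" and "v \<in> W"
  shows "f_d V E v \<le> card W"
proof -
  let ?K = "{k. explorer_guarantees V E v k}"
  have "v \<in> V" using assms by (auto simp: director_closed_def)
  then have "0 \<in> ?K"
    using explorer_guarantees_forces[of v V E 0 0] by simp
  moreover have bound: "k \<le> card W" if "k \<in> ?K" for k
    using director_closed_bound[OF assms] that by simp
  moreover have "finite ?K"
    using bound by (intro finite_subset[of ?K "{..card W}"]) auto
  ultimately show ?thesis
    unfolding f_d_def by (intro Max.boundedI) auto
qed

text \<open>Bounds every guaranteed number by \<open>card V\<close>, which makes the set under
  \<open>Max\<close> finite.\<close>

lemma director_closed_UNIV: "director_closed V E V"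
  by (auto simp: director_closed_def)

lemma f_d_lower:
  assumes "finite V" and "v \<in> V" and "forces V E k r {v} v"
  shows "k \<le> f_d V E v"
proof -
  let ?K = "{k. explorer_guarantees V E v k}"
  have "?K \<subseteq> {..card V}"
    using director_closed_bound[OF assms(1) director_closed_UNIV assms(2)] by auto
  then have "finite ?K" by (rule finite_subset) simp
  then show ?thesis
    unfolding f_d_def using explorer_guarantees_forces[OF assms(2,3)] by simp
qed

section \<open>Distances in the lattice\<close>

text \<open>Subtraction is truncated, so \<open>(a - c) + (c - a)\<close> is the absolute difference.\<close>

fun l1 :: "nat \<times> nat \<Rightarrow> nat \<times> nat \<Rightarrow> nat" where
  "l1 (a, b) (c, d) = (a - c) + (c - a) + ((b - d) + (d - b))"

lemma l1_adj:
  assumes "(z, w) \<in> lattice_adj n m"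
  shows "l1 u w \<le> Suc (l1 u z)"
proof -
  have "(i - Suc j) + (Suc j - i) \<le> Suc ((i - j) + (j - i))"
    "(i - j) + (j - i) \<le> Suc ((i - Suc j) + (Suc j - i))" for i j :: nat
    by linarith+
  then show ?thesis
    using assms by (cases u; cases z; cases w) (auto simp: lattice_adj_def)
qed

lemma l1_walk: "(u, w) \<in> lattice_adj n m ^^ k \<Longrightarrow> l1 u w \<le> k"
proof (induction k arbitrary: w)
  case 0
  then show ?case by (cases w) auto
next
  case (Suc k)
  then obtain z where "(u, z) \<in> lattice_adj n m ^^ k" and zw: "(z, w) \<in> lattice_adj n m"
    by auto
  then have "l1 u z \<le> k" using Suc.IH by blast
  then show ?case using l1_adj[OF zw, of u] by linarith
qed

lemma walk_l1:
  assumes "u \<in> lattice_verts n m" and "w \<in> lattice_verts n m"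
  shows "(u, w) \<in> lattice_adj n m ^^ l1 u w"
  using assms
proof (induction "l1 u w" arbitrary: u)
  case 0
  then show ?case by (cases u; cases w) auto
next
  case (Suc k)
  obtain a b c d where uw: "u = (a, b)" "w = (c, d)" by (cases u; cases w)
  \<comment> \<open>A neighbour of \<open>u\<close> one step nearer to \<open>w\<close>: the first
    coordinate is corrected before the second. The last case means \<open>d < b\<close>, because
    \<open>u\<close> and \<open>w\<close> differ.\<close>
  define z where "z = (if a < c then (a + 1, b) else if c < a then (a - 1, b)
    else if b < d then (a, b + 1) else (a, b - 1))"
  have "k = l1 z w" "z \<in> lattice_verts n m" "(u, z) \<in> lattice_adj n m"
    using Suc.hyps(2) Suc.prems
    by (auto simp: uw z_def lattice_verts_def lattice_adj_def)
  with Suc show ?case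
    by (metis relpow_Suc_I2)
qed

lemma gdist_lattice:
  assumes "u \<in> lattice_verts n m" and "w \<in> lattice_verts n m"
  shows "gdist (lattice_adj n m) u w = enat (l1 u w)"
  unfolding gdist_def
  using walk_l1[OF assms] l1_walk[of u w]
  by (intro antisym INF_lower2[of "l1 u w"] INF_greatest) auto

lemma finite_lattice_verts [simp]: "finite (lattice_verts n m)"
  by (simp add: lattice_verts_def)

lemma director_closed_lattice:
  "director_closed (lattice_verts n m) (lattice_adj n m) W \<longleftrightarrow>
    W \<subseteq> lattice_verts n m \<and> (\<forall>u\<in>W. \<forall>w\<in>lattice_verts n m. \<exists>w'\<in>W. l1 u w' = l1 u w)"
  unfolding director_closed_def
proof (rule conj_cong[OF refl])
  assume W: "W \<subseteq> lattice_verts n m"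
  then show "(\<forall>u\<in>W. \<forall>w\<in>lattice_verts n m. \<exists>w'\<in>W.
      gdist (lattice_adj n m) u w' = gdist (lattice_adj n m) u w) \<longleftrightarrow>
    (\<forall>u\<in>W. \<forall>w\<in>lattice_verts n m. \<exists>w'\<in>W. l1 u w' = l1 u w)"
    by (intro ball_cong bex_cong refl) (simp add: gdist_lattice subsetD[OF W])
qed

lemma forces_step_lattice:
  assumes "u \<in> lattice_verts n m" and "\<exists>w\<in>lattice_verts n m. l1 u w = d"
    and "\<And>w. w \<in> lattice_verts n m \<Longrightarrow> l1 u w = d \<Longrightarrow>
      \<exists>r. forces (lattice_verts n m) (lattice_adj n m) k r (insert w S) w"
  shows "\<exists>r. forces (lattice_verts n m) (lattice_adj n m) k r S u"
proof (rule forces_step[where d = d])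
  show "\<exists>w\<in>lattice_verts n m. gdist (lattice_adj n m) u w = enat d"
    using assms(1,2) by (auto simp: gdist_lattice)
  fix w assume "w \<in> lattice_verts n m" "gdist (lattice_adj n m) u w = enat d"
  then show "\<exists>r. forces (lattice_verts n m) (lattice_adj n m) k r (insert w S) w"
    using assms(1) by (intro assms(3)) (simp_all add: gdist_lattice)
qed simp

section \<open>The Explorer\<close>

definition corners :: "nat \<Rightarrow> nat \<Rightarrow> (nat \<times> nat) set" where
  "corners n m = {1, n} \<times> {1, m}"

fun ecc :: "nat \<Rightarrow> nat \<Rightarrow> nat \<times> nat \<Rightarrow> nat" where
  "ecc n m (a, b) = max (a - 1) (n - a) + max (b - 1) (m - b)"

lemma corners_subset: "1 \<le> n \<Longrightarrow> 1 \<le> m \<Longrightarrow> corners n m \<subseteq> lattice_verts n m"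
  by (auto simp: corners_def lattice_verts_def)

lemma point_at_distance:
  fixes a n t :: nat
  assumes "1 \<le> a" "a \<le> n" "t \<le> max (a - 1) (n - a)"
  shows "\<exists>x\<in>{1..n}. (a - x) + (x - a) = t"
  using assms by (intro bexI[of _ "if t \<le> a - 1 then a - t else a + t"]) auto

lemma vertex_at_distance:
  assumes "(a, b) \<in> lattice_verts n m" and "s \<le> max (a - 1) (n - a)" "t \<le> max (b - 1) (m - b)"
  shows "\<exists>w\<in>lattice_verts n m. l1 (a, b) w = s + t"
proof -
  have ab: "1 \<le> a" "a \<le> n" "1 \<le> b" "b \<le> m"
    using assms(1) by (auto simp: lattice_verts_def)
  obtain x where x: "x \<in> {1..n}" "(a - x) + (x - a) = s"
    using point_at_distance[OF ab(1,2) assms(2)] ..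
  obtain y where y: "y \<in> {1..m}" "(b - y) + (y - b) = t"
    using point_at_distance[OF ab(3,4) assms(3)] ..
  have "(x, y) \<in> lattice_verts n m" using x(1) y(1) by (simp add: lattice_verts_def)
  moreover have "l1 (a, b) (x, y) = s + t" using x(2) y(2) by simp
  ultimately show ?thesis ..
qed

lemma ecc_attained:
  "u \<in> lattice_verts n m \<Longrightarrow> \<exists>w\<in>lattice_verts n m. l1 u w = ecc n m u"
  using vertex_at_distance by (cases u) simp

lemma far_end:
  fixes a c n :: nat
  assumes "1 \<le> a" "a \<le> n" "1 \<le> c" "c \<le> n"
  shows "(a - c) + (c - a) \<le> max (a - 1) (n - a)"
    and "(a - c) + (c - a) = max (a - 1) (n - a) \<Longrightarrow> c = 1 \<or> c = n"
  using assms by (auto simp: max_def split: if_splits)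

text \<open>Each coordinate difference is bounded by its own maximum, so a maximal sum makes both
  maximal, and each is maximal only at an end.\<close>

lemma ecc_corner:
  assumes "u \<in> lattice_verts n m" and "w \<in> lattice_verts n m" and "l1 u w = ecc n m u"
  shows "w \<in> corners n m"
proof -
  obtain a b c d where uw: "u = (a, b)" "w = (c, d)" by (cases u; cases w)
  have x: "1 \<le> a" "a \<le> n" "1 \<le> c" "c \<le> n" and y: "1 \<le> b" "b \<le> m" "1 \<le> d" "d \<le> m"
    using assms by (auto simp: uw lattice_verts_def)
  have "(a - c) + (c - a) + ((b - d) + (d - b)) = max (a - 1) (n - a) + max (b - 1) (m - b)"
    using assms by (simp add: uw)
  then have "(a - c) + (c - a) = max (a - 1) (n - a)" "(b - d) + (d - b) = max (b - 1) (m - b)"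
    using far_end(1)[OF x] far_end(1)[OF y] by linarith+
  then have "(c = 1 \<or> c = n) \<and> (d = 1 \<or> d = m)"
    using far_end(2)[OF x] far_end(2)[OF y] by blast
  then show ?thesis by (auto simp: uw corners_def)
qed

lemma corner_distances:
  assumes "1 \<le> n" "1 \<le> m" "c \<in> corners n m" and "d \<le> n + m - 2"
  shows "\<exists>w\<in>lattice_verts n m. l1 c w = d"
proof -
  obtain a b where c: "c = (a, b)" by (cases c)
  have "c \<in> lattice_verts n m" using assms corners_subset by blast
  \<comment> \<open>From a corner the differences reach \<open>n - 1\<close> and
    \<open>m - 1\<close>; \<open>d\<close> is spent on the first coordinate as far as
    possible.\<close>
  moreover have "min d (n - 1) \<le> max (a - 1) (n - a)" "d - min d (n - 1) \<le> max (b - 1) (m - b)"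
    using assms by (auto simp: c corners_def)
  ultimately have "\<exists>w\<in>lattice_verts n m. l1 c w = min d (n - 1) + (d - min d (n - 1))"
    unfolding c by (rule vertex_at_distance)
  then show ?thesis by simp
qed

lemma forces_via_corner:
  assumes "u \<in> lattice_verts n m"
    and "\<And>c. c \<in> corners n m \<Longrightarrow> c \<in> lattice_verts n m \<Longrightarrow> l1 u c = ecc n m u \<Longrightarrow>
      \<exists>r. forces (lattice_verts n m) (lattice_adj n m) k r (insert c S) c"
  shows "\<exists>r. forces (lattice_verts n m) (lattice_adj n m) k r S u"
  using assms(1) ecc_attained[OF assms(1)]
proof (rule forces_step_lattice)
  fix w assume w: "w \<in> lattice_verts n m" "l1 u w = ecc n m u"
  show "\<exists>r. forces (lattice_verts n m) (lattice_adj n m) k r (insert w S) w"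
    by (rule assms(2)[OF ecc_corner[OF assms(1) w] w])
qed

text \<open>Two turns: \<open>d\<close> leads to an unvisited vertex, the eccentricity there leads
  back to some corner. The hypothesis \<open>IH\<close> is the induction hypothesis of both
  \<open>forces_corner\<close> and \<open>forces_corner_even\<close>, which share this step.\<close>

lemma forces_new_distance:
  assumes "1 \<le> n" "1 \<le> m" "c \<in> corners n m" and "S \<subseteq> lattice_verts n m"
    and "d \<le> n + m - 2" and "d \<notin> l1 c ` S"
    and IH: "\<And>S' c'. card S < card S' \<Longrightarrow> S' \<subseteq> lattice_verts n m \<Longrightarrow> c' \<in> corners n m \<Longrightarrow> c' \<in> S' \<Longrightarrow>
      \<exists>r. forces (lattice_verts n m) (lattice_adj n m) k r S' c'"
  shows "\<exists>r. forces (lattice_verts n m) (lattice_adj n m) k r S c"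
proof (rule forces_step_lattice)
  show "c \<in> lattice_verts n m" using assms(1-3) corners_subset by blast
  show "\<exists>w\<in>lattice_verts n m. l1 c w = d" by (rule corner_distances[OF assms(1-3,5)])
  fix w assume w: "w \<in> lattice_verts n m" "l1 c w = d"
  have fin: "finite S" using assms(4) by (rule finite_subset) simp
  have "w \<notin> S" using w assms(6) by blast
  then have "card S < card (insert w S)" using fin by simp
  also have "card (insert w S) \<le> card (insert c' (insert w S))" for c'
    using fin by (intro card_mono) auto
  finally have card: "card S < card (insert c' (insert w S))" for c' .
  show "\<exists>r. forces (lattice_verts n m) (lattice_adj n m) k r (insert w S) w"
  proof (rule forces_via_corner[OF w(1)])
    fix c' assume "c' \<in> corners n m" "c' \<in> lattice_verts n m"
    then show "\<exists>r. forces (lattice_verts n m) (lattice_adj n m) k r (insert c' (insert w S)) c'"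
      using w(1) assms(4) by (intro IH[OF card]) simp_all
  qed
qed

lemma forces_corner:
  assumes "2 \<le> n" "2 \<le> m" and "S \<subseteq> lattice_verts n m" and "c \<in> corners n m" and "c \<in> S"
  shows "\<exists>r. forces (lattice_verts n m) (lattice_adj n m) (n + m - 1) r S c"
  using assms(3-5)
proof (induction "n + m - 1 - card S" arbitrary: S c rule: less_induct)
  case less
  show ?case
  proof (cases "n + m - 1 \<le> card S")
    case True
    then show ?thesis by (intro exI forces_card)
  next
    case False
    have fin: "finite S" using less.prems(1) by (rule finite_subset) simp
    \<comment> \<open>Pigeonhole: there are \<open>n + m - 1\<close> distances but fewer visited
      vertices.\<close>
    have "\<not> {0..n + m - 2} \<subseteq> l1 c ` S"
    proof
      assume "{0..n + m - 2} \<subseteq> l1 c ` S"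
      from surj_card_le[OF fin this] have "n + m - 1 \<le> card S" using assms(1) by simp
      with False show False ..
    qed
    then obtain d where d: "d \<le> n + m - 2" "d \<notin> l1 c ` S"
      by (meson atLeastAtMost_iff subsetI)
    show ?thesis
      using assms(1,2) less.prems d False
      by (intro forces_new_distance[OF _ _ _ _ d] less.hyps) auto
  qed
qed

section \<open>Parity and the additional vertex for even sides\<close>

lemma even_l1: "even (l1 (a, b) (c, d)) \<longleftrightarrow> even (a + b + c + d)"
proof -
  have "even ((i - j) + (j - i)) \<longleftrightarrow> even (i + j)" for i j :: nat
    by (auto simp: even_diff_nat)
  then show ?thesis
    unfolding l1.simps even_add by blast
qed

text \<open>The lattice is bipartite, coloured by the parity of the coordinate sum, so closed walks
  have even length.\<close>

lemma even_l1_triangle: "even (l1 u v + l1 v w + l1 u w)"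
  by (cases u; cases v; cases w) (simp add: even_l1 del: l1.simps, blast)

text \<open>Otherwise the distances from \<open>c\<close>, and likewise those from \<open>c'\<close>, enumerate
  \<open>0..N\<close> exactly, so all these distances add up to an even number; but each of the
  oddly many vertices contributes an odd number.\<close>

lemma not_both_covered:
  assumes "finite S" and "card S \<le> N + 1" and "even N" and "odd (l1 c c')"
    and "{0..N} \<subseteq> l1 c ` S"
  shows "\<not> {0..N} \<subseteq> l1 c' ` S"
proof
  assume c': "{0..N} \<subseteq> l1 c' ` S"
  have sum: "card S = N + 1 \<and> (\<Sum>s\<in>S. l1 z s) = \<Sum>{0..N}" if z: "{0..N} \<subseteq> l1 z ` S" for z
  proof -
    have "card (l1 z ` S) \<le> card S" using assms(1) by (rule card_image_le)
    then have img: "l1 z ` S = {0..N}"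
      using assms(1,2) card_seteq[OF _ z] by simp
    with assms(2) card_image_le[OF assms(1), of "l1 z"] have card: "card S = N + 1" by simp
    then have "inj_on (l1 z) S"
      using img assms(1) by (intro eq_card_imp_inj_on) auto
    then have "(\<Sum>s\<in>S. l1 z s) = \<Sum>(l1 z ` S)" by (simp add: sum.reindex)
    with img card show ?thesis by simp
  qed
  have "odd (l1 c s + l1 c' s)" for s
    using even_l1_triangle[of c c' s] assms(4) by simp
  then have "odd (\<Sum>s\<in>S. l1 c s + l1 c' s)"
    using even_sum_iff[OF assms(1), of "\<lambda>s. l1 c s + l1 c' s"] sum[OF c'] assms(3) by simp
  then show False
    using sum[OF c'] sum[OF assms(5)] by (simp add: sum.distrib)
qed

text \<open>The distances from \<open>w\<close> to \<open>c\<close> and to the opposite corner add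
  up to \<open>n + m - 2\<close>, so both are \<open>(n + m) div 2 - 1\<close>. A farthest corner is
  at least one step farther away, hence is one of the other two, at distance \<open>n - 1\<close> or
  \<open>m - 1\<close> from \<open>c\<close>.\<close>

lemma middle_distance_switch:
  assumes "even n" "even m" "2 \<le> n" "2 \<le> m" and "c \<in> corners n m" "c' \<in> corners n m"
    and "w \<in> lattice_verts n m" and "l1 c w = (n + m) div 2 - 1" and "l1 w c' = ecc n m w"
  shows "odd (l1 c c')"
proof -
  obtain p q where pq: "n = 2 * p" "m = 2 * q" using assms by (auto elim!: evenE)
  obtain x y where w: "w = (x, y)" by (cases w)
  obtain a b where c: "c = (a, b)" by (cases c)
  have ab: "a = 1 \<or> a = 2 * p" "b = 1 \<or> b = 2 * q"
    using assms(5) by (auto simp: c pq corners_def)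
  have x: "1 \<le> x" "x \<le> 2 * p" and y: "1 \<le> y" "y \<le> 2 * q"
    using assms(7) by (auto simp: w pq lattice_verts_def)
  have "p \<le> max (x - 1) (2 * p - x)" "q \<le> max (y - 1) (2 * q - y)"
    using x y by (auto simp: max_def)
  then have far: "p + q \<le> l1 w c'"
    using assms(9) by (simp add: w pq)
  have near: "l1 w c = p + q - 1"
    using assms(8) by (simp add: w pq c ac_simps)
  \<comment> \<open>\<open>2 * p + 1 - i\<close> is the end other than \<open>i\<close>, and the
    distances from \<open>x\<close> to both ends sum to the length of the side.\<close>
  have flip: "(x - i) + (i - x) + ((x - (2 * p + 1 - i)) + ((2 * p + 1 - i) - x)) = 2 * p - 1"
    if "i = 1 \<or> i = 2 * p" for i
    using that x by auto
  have flip': "(y - i) + (i - y) + ((y - (2 * q + 1 - i)) + ((2 * q + 1 - i) - y)) = 2 * q - 1"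
    if "i = 1 \<or> i = 2 * q" for i
    using that y by auto
  have "l1 w c + l1 w (n + 1 - a, m + 1 - b) = (2 * p - 1) + (2 * q - 1)"
    using flip[OF ab(1)] flip'[OF ab(2)] by (simp add: w c pq)
  then have "l1 w (n + 1 - a, m + 1 - b) = p + q - 1"
    using near x y by linarith
  with near far x have "c' \<noteq> (a, b)" "c' \<noteq> (n + 1 - a, m + 1 - b)"
    by (auto simp: c)
  then have "c' = (a, m + 1 - b) \<or> c' = (n + 1 - a, b)"
    using assms(5,6) by (auto simp: c corners_def)
  then show ?thesis
    using ab by (auto simp: c pq even_l1 simp del: l1.simps)
qed

lemma forces_corner_even:
  assumes "even n" "even m" "2 \<le> n" "2 \<le> m"
    and "S \<subseteq> lattice_verts n m" and "c \<in> corners n m" and "c \<in> S"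
  shows "\<exists>r. forces (lattice_verts n m) (lattice_adj n m) (n + m) r S c"
  using assms(5-7)
proof (induction "n + m - card S" arbitrary: S c rule: less_induct)
  case less
  let ?forced = "\<lambda>S c. \<exists>r. forces (lattice_verts n m) (lattice_adj n m) (n + m) r S c"
  show ?case
  proof (cases "n + m \<le> card S")
    case True
    then show ?thesis by (intro exI forces_card)
  next
    case False
    have IH: "?forced S' c'" if "card S < card S'" "S' \<subseteq> lattice_verts n m"
      "c' \<in> corners n m" "c' \<in> S'" for S' c'
      using that False by (intro less.hyps) auto
    have fin: "finite S" using less.prems(1) by (rule finite_subset) simp
    have uncovered: "?forced S c'"
      if c': "c' \<in> corners n m" "\<not> {0..n + m - 2} \<subseteq> l1 c' ` S" for c'
    proof -
      obtain d where d: "d \<le> n + m - 2" "d \<notin> l1 c' ` S"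
        using c'(2) by (meson atLeastAtMost_iff subsetI)
      show ?thesis
        using assms(3,4) less.prems c' by (intro forces_new_distance[OF _ _ _ _ d] IH) auto
    qed
    show ?thesis
    proof (cases "{0..n + m - 2} \<subseteq> l1 c ` S")
      case False
      then show ?thesis using uncovered less.prems by blast
    next
      case cov: True
      show ?thesis
      proof (rule forces_step_lattice[where d = "(n + m) div 2 - 1"])
        show "c \<in> lattice_verts n m" using less.prems by blast
        show "\<exists>w\<in>lattice_verts n m. l1 c w = (n + m) div 2 - 1"
          using assms(3,4) less.prems by (intro corner_distances) auto
        fix w assume w: "w \<in> lattice_verts n m" "l1 c w = (n + m) div 2 - 1"
        show "?forced (insert w S) w"
        proof (rule forces_via_corner[OF w(1)])
          fix c' assume c': "c' \<in> corners n m" "c' \<in> lattice_verts n m" "l1 w c' = ecc n m w"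
          let ?S = "insert c' (insert w S)"
          \<comment> \<open>Either one of the two turns visited a new vertex and induction applies,
            or \<open>S\<close> is unchanged and by parity misses a distance from
            \<open>c'\<close>.\<close>
          show "?forced ?S c'"
          proof (cases "?S = S")
            case True
            have "odd (l1 c c')"
              using middle_distance_switch[OF assms(1-4) less.prems(2) c'(1) w c'(3)] .
            then have "\<not> {0..n + m - 2} \<subseteq> l1 c' ` S"
              using assms(1-4) False fin cov by (intro not_both_covered[where c = c]) auto
            then show ?thesis using uncovered c'(1) True by simp
          next
            case False
            then have "card S < card ?S"
              using fin by (intro psubset_card_mono) auto
            then show ?thesis
              using less.prems w c' by (intro IH) auto
          qed
        qed
      qed
    qed
  qed
qed

section \<open>The Director\<close>

lemma director_closed_isometry:
  assumes "director_closed (lattice_verts n m) (lattice_adj n m) W"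
    and "f ` lattice_verts n m = lattice_verts n' m'"
    and "\<And>u w. u \<in> lattice_verts n m \<Longrightarrow> w \<in> lattice_verts n m \<Longrightarrow> l1 (f u) (f w) = l1 u w"
  shows "director_closed (lattice_verts n' m') (lattice_adj n' m') (f ` W)"
proof -
  have W: "W \<subseteq> lattice_verts n m"
    "\<And>u w. u \<in> W \<Longrightarrow> w \<in> lattice_verts n m \<Longrightarrow> \<exists>w'\<in>W. l1 u w' = l1 u w"
    using assms(1) by (auto simp: director_closed_lattice)
  have "\<exists>w'\<in>W. l1 (f u) (f w') = l1 (f u) (f w)" if "u \<in> W" "w \<in> lattice_verts n m" for u w
    using W(2)[OF that] W(1) assms(3) that by (metis subsetD)
  then show ?thesis
    using W(1) unfolding director_closed_lattice unfolding assms(2)[symmetric] by auto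
qed

text \<open>The inequality \<open>card W \<le> k\<close> passes to images of \<open>W\<close>
  without any injectivity.\<close>

definition dir_bound :: "nat \<Rightarrow> nat \<Rightarrow> nat \<times> nat \<Rightarrow> nat \<Rightarrow> bool" where
  "dir_bound n m v k \<longleftrightarrow>
     (\<exists>W. director_closed (lattice_verts n m) (lattice_adj n m) W \<and> v \<in> W \<and> card W \<le> k)"

lemma director_closed_finite:
  "director_closed (lattice_verts n m) E W \<Longrightarrow> finite W"
  unfolding director_closed_def using finite_subset finite_lattice_verts by blast

lemma f_d_dir_bound:
  assumes "dir_bound n m v k"
  shows "f_d (lattice_verts n m) (lattice_adj n m) v \<le> k"
  using assms f_d_upper director_closed_finite unfolding dir_bound_def by (metis le_trans)

lemma dir_bound_isometry:
  assumes "dir_bound n m v k"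
    and "f ` lattice_verts n m = lattice_verts n' m'"
    and "\<And>u w. u \<in> lattice_verts n m \<Longrightarrow> w \<in> lattice_verts n m \<Longrightarrow> l1 (f u) (f w) = l1 u w"
  shows "dir_bound n' m' (f v) k"
proof -
  obtain W where W: "director_closed (lattice_verts n m) (lattice_adj n m) W" "v \<in> W" "card W \<le> k"
    using assms(1) unfolding dir_bound_def by blast
  have "card (f ` W) \<le> k"
    using card_image_le[OF director_closed_finite[OF W(1)]] W(3) le_trans by blast
  then show ?thesis
    using director_closed_isometry[OF W(1) assms(2,3)] W(2) unfolding dir_bound_def by blast
qed

lemma dir_bound_reflect_fst:
  assumes "dir_bound n m (n + 1 - a, b) k" and "1 \<le> a" "a \<le> n"
  shows "dir_bound n m (a, b) k"
proof -
  let ?f = "\<lambda>(x, y). (n + 1 - x, y :: nat)"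
  have "?f ` lattice_verts n m = lattice_verts n m"
  proof (intro equalityI subsetI)
    fix z assume "z \<in> lattice_verts n m"
    then show "z \<in> ?f ` lattice_verts n m"
      by (intro image_eqI[where x = "?f z"]) (auto simp: lattice_verts_def)
  qed (auto simp: lattice_verts_def)
  from dir_bound_isometry[OF assms(1) this] have "dir_bound n m (?f (n + 1 - a, b)) k"
    by (auto simp: lattice_verts_def)
  then show ?thesis using assms(2,3) by simp
qed

lemma dir_bound_swap:
  assumes "dir_bound m n (b, a) k"
  shows "dir_bound n m (a, b) k"
proof -
  have "prod.swap ` lattice_verts m n = lattice_verts n m"
    by (auto simp: lattice_verts_def)
  from dir_bound_isometry[OF assms this] have "dir_bound n m (prod.swap (b, a)) k"
    by auto
  then show ?thesis by simp
qed

lemma dir_bound_reflect_snd: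
  assumes "dir_bound n m (a, m + 1 - b) k" and "1 \<le> b" "b \<le> m"
  shows "dir_bound n m (a, b) k"
  by (rule dir_bound_swap[OF dir_bound_reflect_fst[OF dir_bound_swap[OF assms(1)] assms(2,3)]])

text \<open>A monotone path from \<open>(1, 1)\<close> to \<open>(n, m)\<close>, parametrised by the coordinate sum. Every
  vertex on it has one of the two ends as a farthest vertex, since the path changes
  quadrants along the middle column.\<close>

lemma dir_bound_path:
  assumes "n = 2 * p + 1" "2 \<le> m" and "1 \<le> a" "a \<le> p + 1" "1 \<le> b" "2 * b \<le> m + 1"
  shows "dir_bound n m (a, b) (n + m - 1)"
proof -
  \<comment> \<open>With \<open>s\<close> the coordinate sum, the path climbs column 1 to row
    \<open>b\<close>, follows row \<open>b\<close> to the middle column \<open>p + 1\<close>, climbs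
    it to row \<open>m\<close>, and follows row \<open>m\<close> to \<open>(n, m)\<close>.\<close>
  define X where "X s = (if s \<le> b + 1 then 1 else if s \<le> p + 1 + b then s - b
    else if s \<le> p + 1 + m then p + 1 else s - m)" for s
  define P where "P s = (X s, s - X s)" for s
  let ?I = "{2..n + m}"
  have bm: "b \<le> m" using assms by linarith
  have mono: "X s \<le> X t \<and> s - X s \<le> t - X t" if "s \<le> t" for s t
    using that bm by (auto simp: X_def)
  have range: "1 \<le> X s" "X s \<le> n" "1 \<le> s - X s" "s - X s \<le> m" "X s + (s - X s) = s" if "s \<in> ?I" for s
    using that assms(1,5) bm by (auto simp: X_def)
  \<comment> \<open>In the lower left quadrant \<open>(n, m)\<close> is farthest, in the upper right
    one \<open>(1, 1)\<close>; on the middle column both sides are equally far. The assumption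
    \<open>2 * b \<le> m + 1\<close> keeps row \<open>b\<close> in the lower half.\<close>
  have quadrant: "X s \<le> p + 1 \<and> 2 * (s - X s) \<le> m + 1 \<or> X s = p + 1 \<or>
      p + 1 \<le> X s \<and> m + 1 \<le> 2 * (s - X s)" for s
    using assms(2,6) bm by (auto simp: X_def)
  have verts: "P s \<in> lattice_verts n m" if "s \<in> ?I" for s
    using range[OF that] by (simp add: P_def lattice_verts_def)
  have dist_le: "l1 (P s) (P t) = t - s \<and> l1 (P t) (P s) = t - s"
    if "s \<le> t" "s \<in> ?I" "t \<in> ?I" for s t
    using mono[OF that(1)] range(5)[OF that(2)] range(5)[OF that(3)] by (simp add: P_def)
  have dist: "l1 (P s) (P t) = (s - t) + (t - s)" if "s \<in> ?I" "t \<in> ?I" for s t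
    using dist_le[of s t] dist_le[of t s] that by (cases "s \<le> t") auto
  \<comment> \<open>\<open>s - 2\<close> and \<open>n + m - s\<close> are the distances from
    \<open>P s\<close> to the two ends of the path.\<close>
  have ecc: "l1 (P s) w \<le> s - 2 \<or> l1 (P s) w \<le> n + m - s"
    if s: "s \<in> ?I" and w: "w \<in> lattice_verts n m" for s w
  proof -
    define x y where "x = X s" and "y = s - X s"
    note xy = range[OF s, folded x_def y_def] quadrant[of s, folded x_def y_def]
    obtain c d where cd: "w = (c, d)" by (cases w)
    have "1 \<le> c" "c \<le> n" "1 \<le> d" "d \<le> m" using w by (auto simp: cd lattice_verts_def)
    moreover have "P s = (x, y)" by (simp add: P_def x_def y_def)
    ultimately have "l1 (P s) w \<le> max (x - 1) (n - x) + max (y - 1) (m - y)"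
      using xy by (simp only: cd l1.simps) (intro add_mono far_end(1))
    moreover have "max (x - 1) (n - x) + max (y - 1) (m - y) \<le> max (s - 2) (n + m - s)"
      using xy assms(1) by (auto simp: max_def)
    ultimately show ?thesis by (simp add: le_max_iff_disj[symmetric] del: l1.simps)
  qed
  have "\<exists>t\<in>?I. l1 (P s) (P t) = l1 (P s) w" if s: "s \<in> ?I" and w: "w \<in> lattice_verts n m" for s w
  proof -
    \<comment> \<open>Go back along the path if there is room, otherwise forward.\<close>
    let ?t = "if l1 (P s) w \<le> s - 2 then s - l1 (P s) w else s + l1 (P s) w"
    have "?t \<in> ?I" using ecc[OF s w] s by auto
    with dist[OF s this] show ?thesis using ecc[OF s w] s by (intro bexI[of _ ?t]) auto
  qed
  then have "director_closed (lattice_verts n m) (lattice_adj n m) (P ` ?I)"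
    using verts by (auto simp: director_closed_lattice)
  moreover have "(a, b) = P (a + b)" "a + b \<in> ?I"
    using assms by (auto simp: P_def X_def)
  moreover have "card (P ` ?I) \<le> n + m - 1"
    using card_image_le[of ?I P] by simp
  ultimately show ?thesis unfolding dir_bound_def by blast
qed

lemma dir_bound_odd_fst:
  assumes "odd n" "2 \<le> m" "(a, b) \<in> lattice_verts n m"
  shows "dir_bound n m (a, b) (n + m - 1)"
proof -
  obtain p where p: "n = 2 * p + 1" using assms(1) by (auto elim: oddE)
  have ab: "1 \<le> a" "a \<le> n" "1 \<le> b" "b \<le> m" using assms(3) by (auto simp: lattice_verts_def)
  \<comment> \<open>Reflections move the vertex into the lower left quadrant. \<open>a'\<close>
    stays general so that \<open>n + 1 - a\<close> can be inserted as well.\<close>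
  have left: "dir_bound n m (a', b) (n + m - 1)" if a': "1 \<le> a'" "a' \<le> p + 1" for a'
  proof (cases "2 * b \<le> m + 1")
    case True
    then show ?thesis using dir_bound_path[OF p assms(2) a' ab(3)] by blast
  next
    case False
    then have "1 \<le> m + 1 - b" "2 * (m + 1 - b) \<le> m + 1" using ab by auto
    from dir_bound_path[OF p assms(2) a' this] show ?thesis
      using ab(3,4) by (rule dir_bound_reflect_snd)
  qed
  show ?thesis
  proof (cases "a \<le> p + 1")
    case True
    then show ?thesis using left ab by blast
  next
    case False
    then have "1 \<le> n + 1 - a" "n + 1 - a \<le> p + 1" using p ab by auto
    from left[OF this] ab(1,2) show ?thesis by (rule dir_bound_reflect_fst)
  qed
qed

lemma dir_bound_odd:
  assumes "odd n \<or> odd m" "2 \<le> n" "2 \<le> m" "v \<in> lattice_verts n m"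
  shows "dir_bound n m v (n + m - 1)"
proof (cases "odd n")
  case True
  then show ?thesis using assms dir_bound_odd_fst by (cases v) auto
next
  case False
  obtain a b where v: "v = (a, b)" by (cases v)
  have "dir_bound m n (b, a) (n + m - 1)"
    unfolding add.commute[of n m]
    using False assms by (intro dir_bound_odd_fst) (auto simp: v lattice_verts_def)
  then show ?thesis unfolding v by (rule dir_bound_swap)
qed

text \<open>The set has the shape of an H with its bar in row \<open>b\<close>. Short distances stay
  in a column, medium ones go via row \<open>b\<close>, and long ones end in the farther
  column.\<close>

lemma dir_bound_H:
  assumes "2 \<le> n" "(a, b) \<in> lattice_verts n m"
  shows "dir_bound n m (a, b) (2 * m + n - 2)"
proof -
  define W where "W = {1, n} \<times> {1..m} \<union> {2..<n} \<times> {b}"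
  have b: "1 \<le> b" "b \<le> m" using assms(2) by (auto simp: lattice_verts_def)
  have "\<exists>w'\<in>W. l1 u w' = l1 u w" if u: "u \<in> W" and w: "w \<in> lattice_verts n m" for u w
  proof -
    obtain x y where u': "u = (x, y)" by (cases u)
    define d where "d = l1 u w"
    have xy: "1 \<le> x" "x \<le> n" "1 \<le> y" "y \<le> m"
      using u b assms(1) by (auto simp: u' W_def)
    let ?e = "max (x - 1) (n - x)" and ?f = "max (y - 1) (m - y)"
    let ?g = "(y - b) + (b - y)"
    have g: "?g \<le> ?f" using xy b by (intro far_end(1))
    have d: "d \<le> ?e + ?f"
    proof -
      obtain x' y' where w': "w = (x', y')" by (cases w)
      have "1 \<le> x'" "x' \<le> n" "1 \<le> y'" "y' \<le> m" using w by (auto simp: w' lattice_verts_def)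
      then show ?thesis
        unfolding d_def u' w' l1.simps using xy by (intro add_mono far_end(1))
    qed
    \<comment> \<open>\<open>?g\<close> is the distance from \<open>u\<close> to row
      \<open>b\<close>, \<open>?e\<close> that to the farther extreme column. The last case is void:
      off the extreme columns \<open>u\<close> lies in row \<open>b\<close>, so \<open>?g\<close> is
      0.\<close>
    consider "x \<in> {1, n}" "d < ?g" | "?g \<le> d" "d \<le> ?g + ?e" | "?g + ?e < d" | "x \<notin> {1, n}" "d < ?g"
      by linarith
    then have "\<exists>w'\<in>W. l1 u w' = d"
    proof cases
      case 1
      have "d \<le> ?f" using less_imp_le[OF 1(2)] g by (rule order.trans)
      with xy obtain y' where y': "y' \<in> {1..m}" "(y - y') + (y' - y) = d"
        using point_at_distance by blast
      have "(x, y') \<in> W" using y'(1) 1(1) by (simp add: W_def)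
      moreover have "l1 u (x, y') = d" using y'(2) by (simp add: u')
      ultimately show ?thesis ..
    next
      case 2
      then have "d - ?g \<le> ?e" by (simp only: le_diff_conv add.commute)
      with xy obtain z where z: "z \<in> {1..n}" "(x - z) + (z - x) = d - ?g"
        using point_at_distance by blast
      have "(z, b) \<in> W" using z(1) b by (auto simp: W_def)
      moreover have "l1 u (z, b) = d"
        using z(2) 2(1) by (simp only: u' l1.simps le_add_diff_inverse2)
      ultimately show ?thesis ..
    next
      case 3
      \<comment> \<open>The horizontal move to the farther column takes \<open>?e\<close>; the rest
        fits vertically since \<open>d\<close> is at most the eccentricity
        \<open>?e + ?f\<close>.\<close>
      have "d - ?e \<le> ?f" using d by (simp only: le_diff_conv add.commute)
      with xy obtain y' where y': "y' \<in> {1..m}" "(y - y') + (y' - y) = d - ?e"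
        using point_at_distance by blast
      obtain x' where x': "x' \<in> {1..n}" "(x - x') + (x' - x) = ?e"
        using xy point_at_distance by blast
      have "1 \<le> n" using xy by linarith
      with xy x' have "x' = 1 \<or> x' = n" by (intro far_end(2)[of x n x']) auto
      then have "(x', y') \<in> W" using y'(1) by (auto simp: W_def)
      moreover have "?e \<le> d" using 3 by linarith
      then have "l1 u (x', y') = d"
        using x'(2) y'(2) by (simp only: u' l1.simps le_add_diff_inverse)
      ultimately show ?thesis ..
    next
      case 4
      then have "y = b" using u by (auto simp: W_def u')
      then show ?thesis using 4 by simp
    qed
    then show ?thesis by (simp add: d_def)
  qed
  moreover have "W \<subseteq> lattice_verts n m"
    using assms(1) b by (auto simp: W_def lattice_verts_def)
  ultimately have "director_closed (lattice_verts n m) (lattice_adj n m) W"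
    by (simp add: director_closed_lattice)
  moreover have "(a, b) \<in> W"
    using assms by (auto simp: W_def lattice_verts_def)
  moreover have "card W \<le> 2 * m + (n - 2)"
  proof -
    have "card W \<le> card ({1, n} \<times> {1..m}) + card ({2..<n} \<times> {b})"
      unfolding W_def by (rule card_Un_le)
    then show ?thesis using assms(1) by (simp add: card_cartesian_product)
  qed
  ultimately show ?thesis
    using assms(1) unfolding dir_bound_def by (metis Nat.add_diff_assoc)
qed

theorem theorem3p1:
  fixes n m :: nat and v :: "nat \<times> nat"
  assumes "n \<ge> m" and "m \<ge> 2"
    and "v \<in> lattice_verts n m"
  shows "(odd n \<or> odd m \<longrightarrow>
            f_d (lattice_verts n m) (lattice_adj n m) v = n + m - 1) \<and>
         (even n \<and> even m \<longrightarrow>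
            n + m \<le> f_d (lattice_verts n m) (lattice_adj n m) v \<and>
            f_d (lattice_verts n m) (lattice_adj n m) v \<le> 2 * m + n - 2)"
proof (intro conjI impI)
  let ?V = "lattice_verts n m" and ?E = "lattice_adj n m"
  have n: "2 \<le> n" using assms by simp
  have lower: "n + m - 1 \<le> f_d ?V ?E v"
  proof -
    have "\<exists>r. forces ?V ?E (n + m - 1) r {v} v"
      using assms(3)
    proof (rule forces_via_corner)
      fix c assume "c \<in> corners n m" "c \<in> ?V"
      then show "\<exists>r. forces ?V ?E (n + m - 1) r {c, v} c"
        using assms(3) by (intro forces_corner[OF n assms(2)]) auto
    qed
    then show ?thesis by (rule exE) (rule f_d_lower[OF finite_lattice_verts assms(3)])
  qed
  show "f_d ?V ?E v = n + m - 1" if "odd n \<or> odd m"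
    using lower f_d_dir_bound[OF dir_bound_odd[OF that n assms(2,3)]] by simp
  show "n + m \<le> f_d ?V ?E v" if "even n \<and> even m"
  proof -
    have "\<exists>r. forces ?V ?E (n + m) r {v} v"
      using assms(3)
    proof (rule forces_via_corner)
      fix c assume "c \<in> corners n m" "c \<in> ?V"
      then show "\<exists>r. forces ?V ?E (n + m) r {c, v} c"
        using assms(3) that by (intro forces_corner_even[OF _ _ n assms(2)]) auto
    qed
    then show ?thesis by (rule exE) (rule f_d_lower[OF finite_lattice_verts assms(3)])
  qed
  show "f_d ?V ?E v \<le> 2 * m + n - 2"
    using f_d_dir_bound[OF dir_bound_H[OF n, of "fst v" "snd v"]] assms(3) by simp
qed

end
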